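(* Let $G$ be a finite, simple, undirected graph with vertex set $V(G)$. Then $$\alpha(G)\ \ge\ \sum_{v\in V(G)}\frac{1}{d_G(v)+1}\ +\ \sum_{v\in V(G)}\frac{1}{d_G(v)+1}\,\max\left\{\frac{d_G(v)}{d_G(v)+1}-\sum_{u\in N_G(v)}\frac{1}{d_G(u)+1},\ 0\right\}.$$
   Context: For a finite, simple, undirected graph $G$ with vertex set $V(G)$ and a vertex $v\in V(G)$, $N_G(v)$ denotes the neighborhood of $v$ (the set of vertices adjacent to $v$) and $d_G(v)=|N_G(v)|$ its degree. A set $I\subseteq V(G)$ is independent if no two vertices in $I$ are adjacent. The independence number $\alpha(G)$ is the maximum cardinality of an independent set of $G$. *)

theory Defs
  imports Complex_Main "Graph_Theory.Digraph"
begin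

text \<open>Finite simple undirected graphs are those of the locale \<^locale>\<open>graph\<close>: finite
  symmetric digraphs without loops or parallel arcs, so that each undirected edge is a pair of
  opposite arcs.\<close>

definition neighborhood :: "('a, 'b) pre_digraph \<Rightarrow> 'a \<Rightarrow> 'a set" where
  "neighborhood G v = {u \<in> verts G. v \<rightarrow>\<^bsub>G\<^esub> u}"

text \<open>The library's degrees \<^const>\<open>in_degree\<close> and \<^const>\<open>out_degree\<close> count arcs; this one counts
  adjacent vertices.\<close>

definition vertex_degree :: "('a, 'b) pre_digraph \<Rightarrow> 'a \<Rightarrow> nat" where
  "vertex_degree G v = card (neighborhood G v)"

definition independent_set :: "('a, 'b) pre_digraph \<Rightarrow> 'a set \<Rightarrow> bool" where
  "independent_set G I \<longleftrightarrow> I \<subseteq> verts G \<and> (\<forall>u\<in>I. \<forall>v\<in>I. \<not> u \<rightarrow>\<^bsub>G\<^esub> v)"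

definition independence_number :: "('a, 'b) pre_digraph \<Rightarrow> nat" where
  "independence_number G = Max {card I | I. independent_set G I}"

end

theory Submission
  imports Defs "HOL-Combinatorics.Permutations"
begin

text \<open>
  Write \<open>w v = 1 / (d v + 1)\<close>, order the vertices uniformly at random and let \<open>S\<close> be the set of
  vertices that precede all their neighbours. It is independent, and it contains \<open>v\<close> with
  probability exactly \<open>w v\<close>. Let \<open>W\<close> be the set of vertices outside \<open>S\<close> without a neighbour in
  \<open>S\<close>. The same argument, restricted to the vertices of \<open>W\<close>, yields an independent subset of
  \<open>W\<close> with at least \<open>\<Sum>v\<in>W. w v\<close> elements, which can be added to \<open>S\<close>. By the union bound,
  \<open>v\<close> lies in \<open>W\<close> with probability at least \<open>1 - w v - (\<Sum>u\<in>N v. w u)\<close>.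
\<close>

text \<open>Composing with a transposition shows that every element of \<open>A\<close> is equally often the first.\<close>
lemma card_permutations_first:
  fixes f :: "'a \<Rightarrow> nat"
  assumes "finite V" "A \<subseteq> V" "a \<in> A" "inj_on f V"
  shows "card A * card {p. p permutes V \<and> (\<forall>u\<in>A - {a}. f (p a) < f (p u))} = fact (card V)"
proof -
  define P where "P b = {p. p permutes V \<and> (\<forall>u\<in>A - {b}. f (p b) < f (p u))}" for b
  have finA: "finite A" using assms finite_subset by blast
  have fin: "finite {p. p permutes V}" using assms(1) by (rule finite_permutations)
  have sub: "P b \<subseteq> {p. p permutes V}" for b by (auto simp: P_def)
  have le: "card (P b) \<le> card (P c)" if "b \<in> A" "c \<in> A" for b c
  proof (rule card_inj_on_le)
    let ?t = "Transposition.transpose b c"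
    show "inj_on (\<lambda>p. p \<circ> ?t) (P b)"
    proof (rule inj_onI)
      fix p q :: "'a \<Rightarrow> 'a"
      assume "p \<circ> ?t = q \<circ> ?t"
      then have "p \<circ> ?t \<circ> ?t = q \<circ> ?t \<circ> ?t" by simp
      then show "p = q" by (simp add: comp_assoc)
    qed
    have t: "?t permutes V" using that assms(2) by (intro permutes_swap_id) auto
    show "(\<lambda>p. p \<circ> ?t) ` P b \<subseteq> P c"
    proof safe
      fix p assume p: "p \<in> P b"
      \<comment> \<open>Since \<open>?t c = b\<close>, the minimum that \<open>p\<close> attains at
        \<open>b\<close> moves to \<open>c\<close>, while \<open>?t\<close> keeps the rest of
        \<open>A\<close> away from \<open>b\<close>.\<close>
      have "f (p (?t c)) < f (p (?t u))" if u: "u \<in> A" "u \<noteq> c" for u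
      proof -
        have "?t u \<in> A - {b}"
          using u \<open>b \<in> A\<close> \<open>c \<in> A\<close> by (auto simp: Transposition.transpose_def)
        then show ?thesis using p by (simp add: P_def)
      qed
      then show "p \<circ> ?t \<in> P c"
        using p permutes_compose[OF t] by (auto simp: P_def)
    qed
    show "finite (P c)" using fin sub finite_subset by blast
  qed
  have disj: "P b \<inter> P c = {}" if "b \<in> A" "c \<in> A" "b \<noteq> c" for b c
  proof -
    have False if "p \<in> P b" "p \<in> P c" for p
    proof -
      have "f (p b) < f (p c)" "f (p c) < f (p b)"
        using that \<open>b \<in> A\<close> \<open>c \<in> A\<close> \<open>b \<noteq> c\<close> by (auto simp: P_def)
      then show False by simp
    qed
    then show ?thesis by blast
  qed
  have cover: "(\<Union>b\<in>A. P b) = {p. p permutes V}"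
  proof
    show "{p. p permutes V} \<subseteq> (\<Union>b\<in>A. P b)"
    proof
      fix p assume "p \<in> {p. p permutes V}"
      then have p: "p permutes V" by simp
      obtain b where b: "b \<in> A" "\<And>u. u \<in> A \<Longrightarrow> f (p b) \<le> f (p u)"
        using ex_min_if_finite[of "(\<lambda>u. f (p u)) ` A"] finA assms(3) by force
      \<comment> \<open>Both \<open>p\<close> and \<open>f\<close> are injective on
        \<open>V\<close>, so ties cannot occur and the minimum is strict.\<close>
      have "f (p b) < f (p u)" if "u \<in> A" "u \<noteq> b" for u
      proof -
        have "p u \<noteq> p b" using permutes_inj[OF p] that by (auto dest: injD)
        moreover have "p u \<in> V" "p b \<in> V"
          using p that b assms(2) by (auto simp: permutes_in_image)
        ultimately have "f (p u) \<noteq> f (p b)" using assms(4) by (auto dest: inj_onD)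
        then show ?thesis using b(2)[OF \<open>u \<in> A\<close>] by simp
      qed
      then show "p \<in> (\<Union>b\<in>A. P b)" using p b by (auto simp: P_def)
    qed
  qed (use sub in blast)
  have "fact (card V) = card (\<Union>b\<in>A. P b)"
    using card_permutations[OF refl assms(1)] by (simp add: cover)
  also have "\<dots> = (\<Sum>b\<in>A. card (P b))"
    using finA disj finite_subset[OF sub fin] by (intro card_UN_disjoint) auto
  also have "\<dots> = (\<Sum>b\<in>A. card (P a))"
    using le assms(3) by (intro sum.cong refl antisym) auto
  finally show ?thesis by (simp add: P_def)
qed

text \<open>If \<open>h x < g x\<close> held on all of the nonempty set, the sums would compare
  strictly the other way. This extracts one good permutation from an average.\<close>

lemma exists_le_of_sum_le:
  fixes g h :: "'a \<Rightarrow> real"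
  assumes "finite A" "A \<noteq> {}" "sum g A \<le> sum h A"
  shows "\<exists>x\<in>A. g x \<le> h x"
  using sum_strict_mono[OF assms(1,2), of h g] assms(3) by (meson not_le)

text \<open>Double counting: over all permutations this is linearity of expectation, up to the
  factor \<open>card Q\<close>. The weight \<open>c\<close> is 1 for counting leaders and
  \<open>1 / (d + 1)\<close> for weighing the vertices that the leaders leave untouched.\<close>

lemma sum_card_swap:
  fixes c :: "'b \<Rightarrow> real"
  assumes "finite V" "finite Q"
  shows "(\<Sum>p\<in>Q. \<Sum>v\<in>{v\<in>V. R p v}. c v) = (\<Sum>v\<in>V. c v * real (card {p\<in>Q. R p v}))"
proof -
  have "(\<Sum>p\<in>Q. \<Sum>v\<in>{v\<in>V. R p v}. c v) = (\<Sum>v\<in>V. \<Sum>p\<in>{p\<in>Q. R p v}. c v)"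
    by (rule sum.swap_restrict[OF assms(2,1)])
  then show ?thesis by (simp add: mult.commute)
qed

text \<open>The map \<open>f\<close> fixes a reference ordering of the vertices, which the permutation \<open>p\<close> reorders.\<close>
definition leaders :: "('a, 'b) pre_digraph \<Rightarrow> ('a \<Rightarrow> nat) \<Rightarrow> ('a \<Rightarrow> 'a) \<Rightarrow> 'a set" where
  "leaders G f p = {v \<in> verts G. \<forall>u\<in>neighborhood G v. f (p v) < f (p u)}"

context graph
begin

lemma neighborhood_sym: "u \<in> neighborhood G v \<longleftrightarrow> v \<in> neighborhood G u"
proof -
  have "u \<rightarrow>\<^bsub>G\<^esub> v \<longleftrightarrow> v \<rightarrow>\<^bsub>G\<^esub> u"
    using sym_arcs by (auto simp: symmetric_def dest: symD)
  then show ?thesis by (auto simp: neighborhood_def adj_in_verts)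
qed

lemma notin_neighborhood_self: "v \<notin> neighborhood G v"
  using adj_not_same by (auto simp: neighborhood_def)

lemma finite_neighborhood: "finite (neighborhood G v)"
  by (simp add: neighborhood_def)

lemma independent_set_iff:
  "independent_set G I \<longleftrightarrow> I \<subseteq> verts G \<and> (\<forall>u\<in>I. \<forall>v\<in>I. v \<notin> neighborhood G u)"
  by (auto simp: independent_set_def neighborhood_def)

lemma card_le_independence_number:
  assumes "independent_set G I"
  shows "card I \<le> independence_number G"
proof -
  \<comment> \<open>\<open>Max\<close> bounds its elements only on a finite set, and finiteness
    comes from that of the power set of the vertices.\<close>
  have "{card I | I. independent_set G I} \<subseteq> card ` Pow (verts G)"
    by (auto simp: independent_set_def)
  then have "finite {card I | I. independent_set G I}"
    using finite_subset by fastforce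
  then show ?thesis
    unfolding independence_number_def using assms by (intro Max_ge) auto
qed

text \<open>Two adjacent leaders would each have to precede the other.\<close>

lemma independent_leaders: "independent_set G (leaders G f p)"
proof -
  have False if "u \<in> leaders G f p" "v \<in> leaders G f p" "v \<in> neighborhood G u" for u v
  proof -
    have "f (p u) < f (p v)" "f (p v) < f (p u)"
      using that neighborhood_sym[of v u] by (auto simp: leaders_def)
    then show False by simp
  qed
  then show ?thesis by (auto simp: independent_set_iff leaders_def)
qed

text \<open>A vertex is a leader exactly when it comes first in its closed neighborhood, which has
  \<open>vertex_degree G v + 1\<close> elements.\<close>

lemma card_permutations_leader:
  assumes "inj_on f (verts G)" "v \<in> verts G"
  shows "real (card {p. p permutes verts G \<and> v \<in> leaders G f p}) =
    fact (card (verts G)) * (1 / (real (vertex_degree G v) + 1))"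
proof -
  let ?A = "insert v (neighborhood G v)"
  have "?A \<subseteq> verts G" using assms(2) by (auto simp: neighborhood_def)
  from card_permutations_first[OF finite_verts this insertI1 assms(1)]
  have "card ?A * card {p. p permutes verts G \<and> (\<forall>u\<in>?A - {v}. f (p v) < f (p u))} =
    fact (card (verts G))" .
  moreover have "?A - {v} = neighborhood G v"
    using notin_neighborhood_self by auto
  moreover have "card ?A = vertex_degree G v + 1"
    using finite_neighborhood notin_neighborhood_self by (simp add: vertex_degree_def)
  ultimately have "(vertex_degree G v + 1) * card {p. p permutes verts G \<and> v \<in> leaders G f p} =
    fact (card (verts G))"
    using assms(2) by (simp add: leaders_def)
  then have "(real (vertex_degree G v) + 1) *
      real (card {p. p permutes verts G \<and> v \<in> leaders G f p}) = fact (card (verts G))"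
    by (metis of_nat_1 of_nat_add of_nat_fact of_nat_mult)
  then show ?thesis by (simp add: field_simps)
qed

text \<open>The degrees are those in \<open>G\<close>, not in the subgraph induced by \<open>W\<close>; so this is weaker than the
  Caro--Wei bound for that subgraph.\<close>
lemma caro_wei_subset:
  assumes "W \<subseteq> verts G"
  shows "\<exists>J\<subseteq>W. independent_set G J \<and>
    (\<Sum>v\<in>W. 1 / (real (vertex_degree G v) + 1)) \<le> real (card J)"
proof -
  obtain f :: "'a \<Rightarrow> nat" where f: "inj_on f (verts G)"
    using finite_imp_inj_to_nat_seg[OF finite_verts] by blast
  let ?Q = "{p. p permutes verts G}"
  have finQ: "finite ?Q" by (simp add: finite_permutations)
  have finW: "finite W" using assms finite_verts by (rule finite_subset)
  have J: "W \<inter> leaders G f p = {v\<in>W. v \<in> leaders G f p}" for p by auto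
  have "(\<Sum>p\<in>?Q. real (card (W \<inter> leaders G f p))) =
      (\<Sum>v\<in>W. real (card {p\<in>?Q. v \<in> leaders G f p}))"
    using sum_card_swap[OF finW finQ, where c = "\<lambda>_. 1" and R = "\<lambda>p v. v \<in> leaders G f p"]
    by (simp add: J)
  also have "\<dots> = (\<Sum>v\<in>W. fact (card (verts G)) * (1 / (real (vertex_degree G v) + 1)))"
    using assms card_permutations_leader[OF f] by (intro sum.cong refl) auto
  also have "\<dots> = (\<Sum>p\<in>?Q. \<Sum>v\<in>W. 1 / (real (vertex_degree G v) + 1))"
    by (simp add: card_permutations[OF refl] sum_distrib_left)
  \<comment> \<open>Averaging needs a nonempty \<open>?Q\<close>; the identity permutation is a
    member.\<close>
  finally have "\<exists>p\<in>?Q. (\<Sum>v\<in>W. 1 / (real (vertex_degree G v) + 1)) \<le>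
      real (card (W \<inter> leaders G f p))"
    by (intro exists_le_of_sum_le[OF finQ]) (auto intro: permutes_id)
  then obtain p where
    "(\<Sum>v\<in>W. 1 / (real (vertex_degree G v) + 1)) \<le> real (card (W \<inter> leaders G f p))" by blast
  moreover have "independent_set G (W \<inter> leaders G f p)"
    using independent_leaders[of f p] by (auto simp: independent_set_def)
  ultimately show ?thesis by blast
qed

text \<open>The vertices neither in \<open>S\<close> nor adjacent to \<open>S\<close> contain a
  large independent set by \<open>caro_wei_subset\<close>. It is disjoint from \<open>S\<close> and
  no edge joins it to \<open>S\<close>, so the union is independent.\<close>

lemma independence_number_ge_extension:
  assumes "independent_set G S"
  shows "real (card S) +
      (\<Sum>v\<in>{v\<in>verts G. v \<notin> S \<and> neighborhood G v \<inter> S = {}}. 1 / (real (vertex_degree G v) + 1))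
    \<le> real (independence_number G)"
proof -
  let ?W = "{v\<in>verts G. v \<notin> S \<and> neighborhood G v \<inter> S = {}}"
  obtain J where J: "J \<subseteq> ?W" "independent_set G J"
    "(\<Sum>v\<in>?W. 1 / (real (vertex_degree G v) + 1)) \<le> real (card J)"
    using caro_wei_subset[of ?W] by auto
  have "independent_set G (S \<union> J)"
    using J(1,2) assms neighborhood_sym unfolding independent_set_iff by blast
  then have "card (S \<union> J) \<le> independence_number G"
    by (rule card_le_independence_number)
  moreover have "finite S" "finite J"
    using assms J(2) by (auto simp: independent_set_def intro: finite_subset[OF _ finite_verts])
  then have "card (S \<union> J) = card S + card J"
    using J(1) by (intro card_Un_disjoint) auto
  ultimately show ?thesis using J(3) by linarith
qed

text \<open>Every permutation is counted on the right or makes \<open>v\<close> or one of its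
  neighbors a leader, so the union bound applies. The term \<open>d / (d + 1)\<close> is
  \<open>1 - 1 / (d + 1)\<close>, and the maximum with 0 is harmless because a cardinality is
  nonnegative.\<close>

lemma card_permutations_untouched_ge:
  assumes "inj_on f (verts G)" "v \<in> verts G"
  shows "fact (card (verts G)) *
      max (real (vertex_degree G v) / (real (vertex_degree G v) + 1) -
        (\<Sum>u\<in>neighborhood G v. 1 / (real (vertex_degree G u) + 1))) 0
    \<le> real (card {p. p permutes verts G \<and> v \<notin> leaders G f p \<and>
                      neighborhood G v \<inter> leaders G f p = {}})"
    (is "?F * max ?m 0 \<le> real (card ?U)")
proof -
  let ?L = "\<lambda>u. {p. p permutes verts G \<and> u \<in> leaders G f p}"
  let ?N = "neighborhood G v"
  let ?w = "\<lambda>u. 1 / (real (vertex_degree G u) + 1)"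
  have fin: "finite {p. p permutes verts G}" by (simp add: finite_permutations)
  have "{p. p permutes verts G} = ?U \<union> (?L v \<union> (\<Union>u\<in>?N. ?L u))" by auto
  then have "card {p. p permutes verts G} \<le> card ?U + card (?L v \<union> (\<Union>u\<in>?N. ?L u))"
    by (simp only: card_Un_le)
  also have "\<dots> \<le> card ?U + (card (?L v) + card (\<Union>u\<in>?N. ?L u))"
    by (intro add_left_mono card_Un_le)
  also have "\<dots> \<le> card ?U + (card (?L v) + (\<Sum>u\<in>?N. card (?L u)))"
    by (intro add_left_mono card_UN_le finite_neighborhood)
  finally have "real (card {p. p permutes verts G}) \<le>
      real (card ?U + (card (?L v) + (\<Sum>u\<in>?N. card (?L u))))"
    by (rule of_nat_mono)
  then have "?F \<le> real (card ?U) + (real (card (?L v)) + (\<Sum>u\<in>?N. real (card (?L u))))"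
    by (simp only: card_permutations[OF refl finite_verts] of_nat_fact of_nat_add of_nat_sum)
  also have "(\<Sum>u\<in>?N. real (card (?L u))) = (\<Sum>u\<in>?N. ?F * ?w u)"
    by (intro sum.cong refl card_permutations_leader[OF assms(1)]) (simp add: neighborhood_def)
  also have "real (card (?L v)) = ?F * ?w v"
    by (rule card_permutations_leader[OF assms])
  finally have "?F * (1 - ?w v - (\<Sum>u\<in>?N. ?w u)) \<le> real (card ?U)"
    by (simp only: sum_distrib_left[symmetric] right_diff_distrib)
  moreover have "1 - ?w v = real (vertex_degree G v) / (real (vertex_degree G v) + 1)"
    by (simp add: field_simps)
  ultimately have "?F * ?m \<le> real (card ?U)" by simp
  then show ?thesis by (simp add: max_def)
qed

end

theorem theorem1:
  fixes G :: "('a, 'b) pre_digraph"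
  assumes "graph G"
  shows "real (independence_number G) \<ge>
           (\<Sum>v\<in>verts G. 1 / (real (vertex_degree G v) + 1)) +
           (\<Sum>v\<in>verts G. 1 / (real (vertex_degree G v) + 1) *
              max (real (vertex_degree G v) / (real (vertex_degree G v) + 1) -
                   (\<Sum>u\<in>neighborhood G v. 1 / (real (vertex_degree G u) + 1))) 0)"
proof -
  interpret graph G by fact
  obtain f :: "'a \<Rightarrow> nat" where f: "inj_on f (verts G)"
    using finite_imp_inj_to_nat_seg[OF finite_verts] by blast
  let ?Q = "{p. p permutes verts G}"
  let ?F = "fact (card (verts G)) :: real"
  let ?w = "\<lambda>v. 1 / (real (vertex_degree G v) + 1)"
  let ?m = "\<lambda>v. max (real (vertex_degree G v) / (real (vertex_degree G v) + 1) -
                   (\<Sum>u\<in>neighborhood G v. ?w u)) 0"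
  let ?R = "\<lambda>p v. v \<notin> leaders G f p \<and> neighborhood G v \<inter> leaders G f p = {}"
  have finQ: "finite ?Q" by (simp add: finite_permutations)
  \<comment> \<open>This puts the leaders into the comprehension form over \<open>verts G\<close>
    that \<open>sum_card_swap\<close> uses.\<close>
  have L: "leaders G f p = {v\<in>verts G. v \<in> leaders G f p}" for p by (auto simp: leaders_def)
  have "(\<Sum>p\<in>?Q. real (card (leaders G f p))) =
      (\<Sum>v\<in>verts G. real (card {p\<in>?Q. v \<in> leaders G f p}))"
    using sum_card_swap[OF finite_verts finQ, where c = "\<lambda>_. 1" and R = "\<lambda>p v. v \<in> leaders G f p"]
    by (simp flip: L)
  also have "\<dots> = (\<Sum>v\<in>verts G. ?F * ?w v)"
    by (intro sum.cong refl) (simp only: mem_Collect_eq card_permutations_leader[OF f])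
  finally have 1: "(\<Sum>p\<in>?Q. real (card (leaders G f p))) = ?F * (\<Sum>v\<in>verts G. ?w v)"
    by (simp only: sum_distrib_left)
  have "?F * (\<Sum>v\<in>verts G. ?w v * ?m v) = (\<Sum>v\<in>verts G. ?w v * (?F * ?m v))"
    by (simp only: sum_distrib_left mult.left_commute)
  also have "\<dots> \<le> (\<Sum>v\<in>verts G. ?w v * real (card {p\<in>?Q. ?R p v}))"
    using card_permutations_untouched_ge[OF f] by (intro sum_mono mult_left_mono) auto
  also have "\<dots> = (\<Sum>p\<in>?Q. \<Sum>v\<in>{v\<in>verts G. ?R p v}. ?w v)"
    by (rule sum_card_swap[OF finite_verts finQ, symmetric])
  finally have "?F * ((\<Sum>v\<in>verts G. ?w v) + (\<Sum>v\<in>verts G. ?w v * ?m v)) \<le>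
      (\<Sum>p\<in>?Q. real (card (leaders G f p)) + (\<Sum>v\<in>{v\<in>verts G. ?R p v}. ?w v))"
    by (simp only: 1 sum.distrib distrib_left add_left_mono)
  \<comment> \<open>The extension bound holds for every \<open>p\<close>, so it can be summed over
    all permutations; cancelling their number \<open>?F\<close> then gives the claim.\<close>
  also have "\<dots> \<le> (\<Sum>p\<in>?Q. real (independence_number G))"
    by (intro sum_mono independence_number_ge_extension independent_leaders)
  also have "\<dots> = ?F * real (independence_number G)"
    by (simp add: card_permutations[OF refl])
  finally show ?thesis by (simp only: mult_le_cancel_left_pos[OF fact_gt_zero])
qed

end
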